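(* Let $n\ge3$ and $m\ge1$ be integers, $q$ a prime power, and let $(\mathsf{Enc},\mathcal{A})$ be any $n$-party one-round aggregation protocol over $\mathbb{F}_q$ in the anonymized model with encoder $\mathsf{Enc}:\mathbb{F}_q\to[\ell]^m$. Then there exists $\mathbf{x}\in\mathbb{F}_q^n$ with $\sum_ix_i=0$ such that $$\mathrm{SD}\left(\mathcal{S}^{\mathsf{Enc}}_{\mathbf{0}},\mathcal{S}^{\mathsf{Enc}}_{\mathbf{x}}\right)\ge\frac{1}{(10nm)^{5m}},$$ where $\mathbf{0}$ is the all-zero input vector.
   Context: $\mathrm{SD}$ is statistical distance. An $n$-party one-round aggregation protocol over $\mathbb{F}_q$ with $m$ messages per party consists of a randomized encoder $\mathsf{Enc}:\mathbb{F}_q\to[\ell]^m$ (for some positive integer $\ell$; each party applies it to its input with independent randomness) and an analyzer $\mathcal{A}:[\ell]^{nm}\to\mathbb{F}_q$ such that for every $\mathbf{x}\in\mathbb{F}_q^n$, every possible realization of the encodings $\mathsf{Enc}(x_1),\dots,\mathsf{Enc}(x_n)$, and every permutation $\pi$ of $[nm]$, the analyzer applied to the concatenation $(\mathsf{Enc}(x_1),\dots,\mathsf{Enc}(x_n))$ with coordinates permuted by $\pi$ outputs $\sum_i x_i$. $\mathcal{S}^{\mathsf{Enc}}_{\mathbf{x}}$ is the distribution on $[\ell]^{nm}$ of this concatenation after applying an independent uniformly random permutation of the $nm$ coordinates. *)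

theory Defs
  imports "HOL-Probability.Probability" "HOL-Combinatorics.Permutations"
begin

fun encs :: "('a \<Rightarrow> 'b list pmf) \<Rightarrow> 'a list \<Rightarrow> 'b list list pmf" where
  "encs E [] = return_pmf []"
| "encs E (x # xs) = do { e \<leftarrow> E x; es \<leftarrow> encs E xs; return_pmf (e # es) }"

definition shuffled :: "('a \<Rightarrow> 'b list pmf) \<Rightarrow> 'a list \<Rightarrow> 'b list pmf" where
  "shuffled E xs = do {
     es \<leftarrow> encs E xs;
     \<pi> \<leftarrow> pmf_of_set {\<pi>. \<pi> permutes {..<length (concat es)}};
     return_pmf (permute_list \<pi> (concat es)) }"

definition SD :: "'b pmf \<Rightarrow> 'b pmf \<Rightarrow> real" where
  "SD p q = (SUP A. \<bar>measure_pmf.prob p A - measure_pmf.prob q A\<bar>)"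

definition is_agg_protocol ::
  "nat \<Rightarrow> nat \<Rightarrow> nat \<Rightarrow> ('a::field \<Rightarrow> nat list pmf) \<Rightarrow> (nat list \<Rightarrow> 'a) \<Rightarrow> bool" where
  "is_agg_protocol n m l Enc A \<longleftrightarrow>
     0 < l \<and>
     (\<forall>x e. e \<in> set_pmf (Enc x) \<longrightarrow> length e = m \<and> (\<forall>y \<in> set e. y \<in> {1..l})) \<and>
     (\<forall>xs es \<pi>. length xs = n \<longrightarrow> length es = n \<longrightarrow>
        (\<forall>i<n. es ! i \<in> set_pmf (Enc (xs ! i))) \<longrightarrow>
        \<pi> permutes {..<n * m} \<longrightarrow>
        A (permute_list \<pi> (concat es)) = sum_list xs)"

end

(* Let G x be the expectation, over the encoding e of x, of the polynomial
   prod_{a in e} (1 + z_a), and measure polynomials by the l1 norm in which a monomial of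
   degree d has weight r^d, where r = 1/(3nm). This norm is submultiplicative and every
   product of at most n factors G x is within 1/2 of 1, so such a product can be cancelled
   at the cost of a factor 2.
   If all zero-sum inputs are eps-close to the zero input, then each product of the G x_i
   over a zero-sum input is within 3 eps of (G 0)^n. Comparing the inputs
   (x, y, -x-y, 0, ..., 0) and (x+y, -x-y, 0, ..., 0) shows that G x * G y is close to
   G (x+y) * G 0; averaging over y and cancelling the mean of the G y gives
   ||G x - G 0|| <= 24 eps, with no dependence on q.
   The degree-m part of G x - G 0 is the difference of the distributions of the multisets
   Enc x and Enc 0, whose supports are disjoint when x is nonzero, hence
   ||G x - G 0|| >= r^m. *)

theory Submission
  imports Defs "HOL-Library.Poly_Mapping"
begin

text \<open>Polynomials in commuting variables \<open>z\<^sub>b\<close>: a multiset stands for the monomial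
  that is the product of its variables.\<close>

type_synonym 'b gf = "'b multiset \<Rightarrow>\<^sub>0 real"

section \<open>Weighted l1 norm on polynomials\<close>

definition wnorm :: "real \<Rightarrow> 'b gf \<Rightarrow> real" where
  "wnorm r f = (\<Sum>k\<in>Poly_Mapping.keys f. \<bar>Poly_Mapping.lookup f k\<bar> * r ^ size k)"

lemma wnorm_superset:
  assumes "finite S" "Poly_Mapping.keys f \<subseteq> S"
  shows "wnorm r f = (\<Sum>k\<in>S. \<bar>Poly_Mapping.lookup f k\<bar> * r ^ size k)"
  unfolding wnorm_def using assms
  by (intro sum.mono_neutral_left) (auto simp: in_keys_iff)

lemma wnorm_nonneg: "0 \<le> r \<Longrightarrow> 0 \<le> wnorm r f"
  unfolding wnorm_def by (intro sum_nonneg) auto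

lemma wnorm_zero [simp]: "wnorm r 0 = 0"
  by (simp add: wnorm_def)

lemma wnorm_single: "wnorm r (Poly_Mapping.single k c) = \<bar>c\<bar> * r ^ size k"
  by (simp add: wnorm_def)

lemma wnorm_uminus [simp]: "wnorm r (- f) = wnorm r f"
  by (simp add: wnorm_def)

lemma wnorm_minus_commute: "wnorm r (f - g) = wnorm r (g - f)"
  using wnorm_uminus[of r "f - g"] by (simp only: minus_diff_eq)

lemma wnorm_add:
  assumes "0 \<le> r" shows "wnorm r (f + g) \<le> wnorm r f + wnorm r g"
proof -
  let ?S = "Poly_Mapping.keys f \<union> Poly_Mapping.keys g"
  have "wnorm r (f + g) = (\<Sum>k\<in>?S. \<bar>Poly_Mapping.lookup f k + Poly_Mapping.lookup g k\<bar> * r ^ size k)"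
    by (subst wnorm_superset[of ?S]) (auto simp: lookup_add Poly_Mapping.keys_add dest: Poly_Mapping.keys_add[THEN subsetD])
  also have "\<dots> \<le> (\<Sum>k\<in>?S. \<bar>Poly_Mapping.lookup f k\<bar> * r ^ size k + \<bar>Poly_Mapping.lookup g k\<bar> * r ^ size k)"
    using assms by (intro sum_mono) (auto simp flip: distrib_right intro!: mult_right_mono)
  also have "\<dots> = wnorm r f + wnorm r g"
    by (simp add: sum.distrib wnorm_superset[of ?S f] wnorm_superset[of ?S g])
  finally show ?thesis .
qed

lemma wnorm_diff:
  assumes "0 \<le> r" shows "wnorm r (f - g) \<le> wnorm r f + wnorm r g"
  using wnorm_add[OF assms, of f "- g"] by simp

lemma wnorm_sum:
  assumes "0 \<le> r" shows "wnorm r (\<Sum>i\<in>I. f i) \<le> (\<Sum>i\<in>I. wnorm r (f i))"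
proof (induction I rule: infinite_finite_induct)
  case (insert i I)
  then show ?case using wnorm_add[OF assms, of "f i" "sum f I"] by simp
qed simp_all

text \<open>Weights multiply because \<open>size (k + l) = size k + size l\<close>, so the triangle
  inequality on the expansion into monomials is enough.\<close>

lemma wnorm_mult:
  assumes "0 \<le> r" shows "wnorm r (f * g) \<le> wnorm r f * wnorm r g"
proof -
  have mon: "h = (\<Sum>k\<in>Poly_Mapping.keys h. Poly_Mapping.single k (Poly_Mapping.lookup h k))" for h :: "'a gf"
    by (rule poly_mapping_eqI)
      (auto simp: lookup_sum lookup_single when_def in_keys_iff)
  have "f * g = (\<Sum>k\<in>Poly_Mapping.keys f. \<Sum>l\<in>Poly_Mapping.keys g. Poly_Mapping.single (k + l) (Poly_Mapping.lookup f k * Poly_Mapping.lookup g l))"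
    by (subst mon[of f], subst mon[of g]) (simp add: sum_product mult_single)
  hence "wnorm r (f * g) \<le> (\<Sum>k\<in>Poly_Mapping.keys f. wnorm r
      (\<Sum>l\<in>Poly_Mapping.keys g. Poly_Mapping.single (k + l) (Poly_Mapping.lookup f k * Poly_Mapping.lookup g l)))"
    by (simp only:) (rule wnorm_sum[OF assms])
  also have "\<dots> \<le> (\<Sum>k\<in>Poly_Mapping.keys f. \<Sum>l\<in>Poly_Mapping.keys g. wnorm r (Poly_Mapping.single (k + l) (Poly_Mapping.lookup f k * Poly_Mapping.lookup g l)))"
    by (intro sum_mono wnorm_sum assms)
  also have "\<dots> = wnorm r f * wnorm r g"
    by (simp add: wnorm_single wnorm_def[of r f] wnorm_def[of r g] sum_product abs_mult power_add mult_ac)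
  finally show ?thesis .
qed

lemma lookup_const_mult:
  "Poly_Mapping.lookup (Poly_Mapping.single 0 c * f) k = c * Poly_Mapping.lookup f k"
  for f :: "'b gf"
  by (simp add: Poly_Mapping.map.rep_eq when_def flip: mult_map_scale_conv_mult)

lemma wnorm_const_mult:
  assumes "0 \<le> r" shows "wnorm r (Poly_Mapping.single 0 c * f) \<le> \<bar>c\<bar> * wnorm r f"
  using wnorm_mult[OF assms, of "Poly_Mapping.single 0 c" f] by (simp add: wnorm_single)

section \<open>Polynomials close to 1, and families with nearly constant products\<close>

lemma wnorm_le_near_one:
  assumes "0 \<le> r" "wnorm r (f - 1) \<le> c - 1" shows "wnorm r f \<le> c"
proof -
  have "wnorm r (1 :: 'a gf) = 1" using wnorm_single[of r "0 :: 'a multiset" 1] by simp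
  moreover have "wnorm r (f - 1 + 1) \<le> wnorm r (f - 1) + wnorm r (1 :: 'a gf)"
    by (rule wnorm_add) fact
  ultimately show ?thesis using assms(2) by simp
qed

text \<open>Bounds of the form \<open>c - 1\<close> compose: in \<open>f * (g - 1) + (f - 1)\<close>
  the first summand costs \<open>c * (d - 1)\<close>, the second \<open>c - 1\<close>.\<close>

lemma near_one_mult:
  assumes "0 \<le> r" "wnorm r (f - 1) \<le> c - 1" "wnorm r (g - 1) \<le> d - 1"
  shows "wnorm r (f * g - 1) \<le> c * d - 1"
proof -
  have fc: "wnorm r f \<le> c" by (rule wnorm_le_near_one) fact+
  have "f * g - 1 = f * (g - 1) + (f - 1)" by (simp add: algebra_simps)
  hence "wnorm r (f * g - 1) \<le> wnorm r (f * (g - 1)) + wnorm r (f - 1)"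
    using wnorm_add[OF assms(1), of "f * (g - 1)" "f - 1"] by (simp only:)
  also have "\<dots> \<le> wnorm r f * wnorm r (g - 1) + wnorm r (f - 1)"
    by (intro add_right_mono wnorm_mult assms)
  also have "\<dots> \<le> c * (d - 1) + (c - 1)"
    using assms fc wnorm_nonneg[OF assms(1)]
    by (intro add_mono mult_mono) (auto intro: order_trans)
  finally show ?thesis by (simp add: algebra_simps)
qed

lemma near_one_power:
  assumes "0 \<le> r" "wnorm r (f - 1) \<le> c - 1"
  shows "wnorm r (f ^ k - 1) \<le> c ^ k - 1"
  by (induction k) (use assms in \<open>auto intro: near_one_mult\<close>)

text \<open>Replaces division by \<open>w\<close>: the error \<open>(w - 1) * f\<close> has at most
  half the norm of \<open>f\<close> and is absorbed on the left.\<close>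

lemma wnorm_cancel_near_one:
  assumes "0 \<le> r" "wnorm r (w - 1) \<le> 1 / 2"
  shows "wnorm r f \<le> 2 * wnorm r (w * f)"
proof -
  have "f = w * f - (w - 1) * f" by (simp add: algebra_simps)
  hence "wnorm r f \<le> wnorm r (w * f) + wnorm r (w - 1) * wnorm r f"
    using wnorm_diff[OF assms(1), of "w * f" "(w - 1) * f"] wnorm_mult[OF assms(1), of "w - 1" f]
    by simp
  moreover have "wnorm r (w - 1) * wnorm r f \<le> 1 / 2 * wnorm r f"
    by (intro mult_right_mono assms wnorm_nonneg)
  ultimately show ?thesis by simp
qed

text \<open>The constant 8 is a factor 2 from comparing two inputs and a factor 2 from each of two
  cancellations. Averaging over the group costs nothing, which keeps its order out of the
  bound.\<close>

lemma almost_constant_of_zero_sum_products: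
  fixes G :: "'a::{ab_group_add,finite} \<Rightarrow> 'b gf"
  assumes r: "0 \<le> r" and n: "3 \<le> n" and c: "1 \<le> c" "c ^ n \<le> 3 / 2"
    and near: "\<And>x. wnorm r (G x - 1) \<le> c - 1"
    and prods: "\<And>xs. length xs = n \<Longrightarrow> sum_list xs = 0 \<Longrightarrow>
       wnorm r (prod_list (map G xs) - G 0 ^ n) \<le> \<eta>"
  shows "wnorm r (G x - G 0) \<le> 8 * \<eta>"
proof -
  have pow: "c ^ k \<le> 3 / 2" if "k \<le> n" for k
    using power_increasing[OF that c(1)] c(2) by simp
  have zeros: "sum_list (replicate k (0 :: 'a)) = 0" for k
    by (induction k) auto
  \<comment> \<open>Both zero-sum inputs contain \<open>- x - y\<close> and \<open>n - 3\<close>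
    zeros; these shared entries form \<open>?W\<close>, a product of \<open>n - 2\<close> values of
    \<open>G\<close>, which can be cancelled.\<close>
  have K: "wnorm r (G x * G y - G (x + y) * G 0) \<le> 4 * \<eta>" for y
  proof -
    let ?z = "- x - y"
    let ?W = "G ?z * G 0 ^ (n - 3)"
    have 1: "wnorm r (G x * (G y * (G ?z * G 0 ^ (n - 3))) - G 0 ^ n) \<le> \<eta>"
      using prods[of "[x, y, ?z] @ replicate (n - 3) 0"] n zeros by (simp add: Suc_diff_le)
    have 2: "wnorm r (G (x + y) * (G ?z * (G 0 * G 0 ^ (n - 3))) - G 0 ^ n) \<le> \<eta>"
      using prods[of "[x + y, ?z, 0] @ replicate (n - 3) 0"] n zeros by simp
    have "?W * (G x * G y - G (x + y) * G 0) =
        (G x * (G y * (G ?z * G 0 ^ (n - 3))) - G 0 ^ n)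
        - (G (x + y) * (G ?z * (G 0 * G 0 ^ (n - 3))) - G 0 ^ n)"
      by (simp add: algebra_simps)
    hence "wnorm r (?W * (G x * G y - G (x + y) * G 0)) \<le> 2 * \<eta>"
      using wnorm_diff[OF r] 1 2 by (smt (verit))
    moreover have "wnorm r (?W - 1) \<le> c * c ^ (n - 3) - 1"
      by (intro near_one_mult near_one_power r near)
    moreover have "c * c ^ (n - 3) \<le> 3 / 2"
      using pow[of "Suc (n - 3)"] n by simp
    ultimately show ?thesis
      using wnorm_cancel_near_one[OF r, of ?W "G x * G y - G (x + y) * G 0"] by fastforce
  qed
  let ?q = "real CARD('a)" and ?D = "G x - G 0"
  \<comment> \<open>The mean of the \<open>G y\<close>; as an average of polynomials near 1 it is
    itself within 1/2 of 1.\<close>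
  define u :: "'b gf" where "u = Poly_Mapping.single 0 (1 / ?q) * (\<Sum>y\<in>UNIV. G y)"
  have const: "Poly_Mapping.single 0 (1 / ?q) * (\<Sum>y\<in>(UNIV :: 'a set). (1 :: 'b gf)) = 1"
  proof -
    have "(\<Sum>y\<in>(UNIV :: 'a set). (1 :: 'b gf)) = Poly_Mapping.single 0 ?q"
      by (simp add: single_of_nat)
    thus ?thesis by (simp only: mult_single) simp
  qed
  have avg: "wnorm r (Poly_Mapping.single 0 (1 / ?q) * (\<Sum>y\<in>UNIV. F y)) \<le> b"
    if "\<And>y. wnorm r (F y) \<le> b" for F :: "'a \<Rightarrow> 'b gf" and b
  proof -
    have "wnorm r (Poly_Mapping.single 0 (1 / ?q) * (\<Sum>y\<in>UNIV. F y)) \<le> 1 / ?q * wnorm r (\<Sum>y\<in>UNIV. F y)"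
      using wnorm_const_mult[OF r, of "1 / ?q"] by simp
    also have "\<dots> \<le> 1 / ?q * (\<Sum>y\<in>(UNIV :: 'a set). b)"
      by (intro mult_left_mono order_trans[OF wnorm_sum[OF r]] sum_mono that) auto
    finally show ?thesis by simp
  qed
  have "u - 1 = Poly_Mapping.single 0 (1 / ?q) * (\<Sum>y\<in>UNIV. G y - 1)"
    unfolding u_def by (subst const[symmetric]) (simp add: sum_subtractf right_diff_distrib)
  hence "wnorm r (u - 1) \<le> c - 1"
    by (simp only:) (intro avg near)
  hence "wnorm r (u - 1) \<le> 1 / 2"
    using pow[of 1] n by simp
  moreover have "u * ?D = Poly_Mapping.single 0 (1 / ?q) * (\<Sum>y\<in>UNIV. G x * G y - G (x + y) * G 0)"
  proof -
    \<comment> \<open>Translation by \<open>x\<close> permutes the group, so both families have the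
      same sum and \<open>?D\<close> factors out of the average.\<close>
    have "(\<Sum>y\<in>UNIV. G (x + y)) = (\<Sum>y\<in>UNIV. G y)"
      by (rule sum.reindex_bij_witness[of _ "\<lambda>y. y - x" "\<lambda>y. x + y"]) auto
    hence "(\<Sum>y\<in>UNIV. G x * G y - G (x + y) * G 0) = (\<Sum>y\<in>UNIV. G y) * ?D"
      by (simp add: sum_subtractf right_diff_distrib mult.commute[of "G x"]
          flip: sum_distrib_right)
    thus ?thesis by (simp add: u_def mult.assoc)
  qed
  hence "wnorm r (u * ?D) \<le> 4 * \<eta>"
    using avg K by simp
  ultimately show ?thesis using wnorm_cancel_near_one[OF r, of u ?D] by simp
qed

section \<open>Shifted monomials and generating functions of random multisets\<close>

definition shifted_monom :: "'b multiset \<Rightarrow> 'b gf" where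
  "shifted_monom M = (\<Prod>a\<in>#M. 1 + Poly_Mapping.single {#a#} 1)"

lemma shifted_monom_empty [simp]: "shifted_monom {#} = 1"
  by (simp add: shifted_monom_def)

lemma shifted_monom_union: "shifted_monom (M + N) = shifted_monom M * shifted_monom N"
  by (simp add: shifted_monom_def)

text \<open>The purpose of shifting the variables by 1: each factor is at distance \<open>r\<close>
  from 1 and these bounds compose, whereas a bare monomial of positive degree is at distance more
  than 1 when \<open>r\<close> is positive.\<close>

lemma shifted_monom_near_one:
  assumes "0 \<le> r" shows "wnorm r (shifted_monom M - 1) \<le> (1 + r) ^ size M - 1"
proof (induction M)
  case (add a M)
  have "wnorm r ((1 + Poly_Mapping.single {#a#} 1) * shifted_monom M - 1) \<le> (1 + r) * (1 + r) ^ size M - 1"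
    by (intro near_one_mult add assms) (simp add: wnorm_single)
  then show ?case by (simp add: shifted_monom_def)
qed simp

text \<open>The product expands to \<open>M\<close> plus monomials of smaller degree, so the shift
  leaves top-degree coefficients readable.\<close>

lemma lookup_shifted_monom:
  assumes "size M \<le> size N"
  shows "Poly_Mapping.lookup (shifted_monom M) N = (if N = M then 1 else 0)"
proof -
  have "\<exists>R. shifted_monom M = Poly_Mapping.single M 1 + R \<and> (\<forall>k\<in>Poly_Mapping.keys R. size k < size M)"
  proof (induction M)
    case empty
    then show ?case by (intro exI[of _ 0]) simp
  next
    case (add a M)
    then obtain R where R: "shifted_monom M = Poly_Mapping.single M 1 + R"
      "\<forall>k\<in>Poly_Mapping.keys R. size k < size M" by blast
    let ?z = "Poly_Mapping.single {#a#} (1::real)"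
    let ?R = "Poly_Mapping.single M 1 + R + ?z * R"
    have "shifted_monom (add_mset a M) = (1 + ?z) * shifted_monom M"
      by (simp add: shifted_monom_def)
    also have "\<dots> = Poly_Mapping.single (add_mset a M) 1 + ?R"
      by (simp add: R(1) algebra_simps mult_single)
    finally have "shifted_monom (add_mset a M) = Poly_Mapping.single (add_mset a M) 1 + ?R" .
    moreover have "size k < size (add_mset a M)" if "k \<in> Poly_Mapping.keys ?R" for k
    proof -
      have "k \<in> {M} \<union> Poly_Mapping.keys R \<union> Poly_Mapping.keys (?z * R)"
        using that Poly_Mapping.keys_add[of "Poly_Mapping.single M 1 + R" "?z * R"]
          Poly_Mapping.keys_add[of "Poly_Mapping.single M 1" R] by auto
      then show ?thesis using R(2) keys_mult[of ?z R] by fastforce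
    qed
    ultimately show ?case by blast
  qed
  then obtain R where R: "shifted_monom M = Poly_Mapping.single M 1 + R"
    "\<forall>k\<in>Poly_Mapping.keys R. size k < size M" by blast
  hence "N \<notin> Poly_Mapping.keys R" using assms by force
  hence "Poly_Mapping.lookup R N = 0" by (simp add: in_keys_iff)
  then show ?thesis by (auto simp: R(1) lookup_add lookup_single)
qed

text \<open>The expectation of \<open>shifted_monom\<close> under \<open>P\<close>, with scalars as
  constant polynomials. The sum defaults to 0 on an infinite support, hence the finiteness
  hypotheses below.\<close>

definition genfun :: "'b multiset pmf \<Rightarrow> 'b gf" where
  "genfun P = (\<Sum>M\<in>set_pmf P. Poly_Mapping.single 0 (pmf P M) * shifted_monom M)"

lemma genfun_superset:
  assumes "finite S" "set_pmf P \<subseteq> S"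
  shows "genfun P = (\<Sum>M\<in>S. Poly_Mapping.single 0 (pmf P M) * shifted_monom M)"
  unfolding genfun_def using assms
  by (intro sum.mono_neutral_left) (auto simp: set_pmf_iff)

lemma single_0_sum: "Poly_Mapping.single 0 (\<Sum>i\<in>I. f i) = (\<Sum>i\<in>I. Poly_Mapping.single 0 (f i))"
  by (induction I rule: infinite_finite_induct) (auto simp: single_add)

lemma genfun_bind:
  assumes "finite (set_pmf P)" "\<And>x. x \<in> set_pmf P \<Longrightarrow> finite (set_pmf (F x))"
  shows "genfun (bind_pmf P F) = (\<Sum>x\<in>set_pmf P. Poly_Mapping.single 0 (pmf P x) * genfun (F x))"
proof -
  let ?S = "\<Union>x\<in>set_pmf P. set_pmf (F x)"
  have fin: "finite ?S" using assms by blast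
  have "pmf (bind_pmf P F) M = (\<Sum>x\<in>set_pmf P. pmf P x * pmf (F x) M)" for M
    by (simp add: pmf_bind integral_measure_pmf[OF assms(1)])
  hence "genfun (bind_pmf P F) = (\<Sum>M\<in>?S. \<Sum>x\<in>set_pmf P.
      Poly_Mapping.single 0 (pmf P x) * (Poly_Mapping.single 0 (pmf (F x) M) * shifted_monom M))"
    using fin by (subst genfun_superset[of ?S])
      (simp_all add: single_0_sum sum_distrib_right mult_single flip: mult.assoc)
  also have "\<dots> = (\<Sum>x\<in>set_pmf P. Poly_Mapping.single 0 (pmf P x) * genfun (F x))"
  proof (subst sum.swap, intro sum.cong refl)
    fix x assume "x \<in> set_pmf P"
    hence "genfun (F x) = (\<Sum>M\<in>?S. Poly_Mapping.single 0 (pmf (F x) M) * shifted_monom M)"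
      by (intro genfun_superset fin) blast
    thus "(\<Sum>M\<in>?S. Poly_Mapping.single 0 (pmf P x) *
        (Poly_Mapping.single 0 (pmf (F x) M) * shifted_monom M)) =
        Poly_Mapping.single 0 (pmf P x) * genfun (F x)"
      by (simp add: sum_distrib_left)
  qed
  finally show ?thesis .
qed

lemma genfun_return [simp]: "genfun (return_pmf M) = shifted_monom M"
  by (simp add: genfun_def)

lemma genfun_map:
  assumes "finite (set_pmf P)"
  shows "genfun (map_pmf f P) = (\<Sum>x\<in>set_pmf P. Poly_Mapping.single 0 (pmf P x) * shifted_monom (f x))"
  using genfun_bind[OF assms, of "\<lambda>x. return_pmf (f x)"] by (simp add: map_pmf_def)

section \<open>Joint encodings and the shuffle\<close>

lemma finite_set_pmf_encs:
  assumes "\<And>x. finite (set_pmf (E x))" shows "finite (set_pmf (encs E xs))"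
  by (induction xs) (auto simp: assms)

text \<open>The parties encode independently and \<open>shifted_monom\<close> turns multiset union
  into a product, so the expectation factors.\<close>

lemma genfun_encs:
  assumes fin: "\<And>x. finite (set_pmf (E x))"
  shows "genfun (map_pmf (\<lambda>es. mset (concat es)) (encs E xs)) =
    prod_list (map (\<lambda>x. genfun (map_pmf mset (E x))) xs)"
proof (induction xs)
  case (Cons x xs)
  let ?R = "encs E xs"
  have finR: "finite (set_pmf ?R)" by (intro finite_set_pmf_encs fin)
  have "map_pmf (\<lambda>es. mset (concat es)) (encs E (x # xs)) =
      bind_pmf (E x) (\<lambda>e. map_pmf (\<lambda>es. mset e + mset (concat es)) ?R)"
    by (simp add: map_bind_pmf map_pmf_def[of _ ?R])
  hence "genfun (map_pmf (\<lambda>es. mset (concat es)) (encs E (x # xs))) =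
      (\<Sum>e\<in>set_pmf (E x). \<Sum>es\<in>set_pmf ?R. Poly_Mapping.single 0 (pmf (E x) e) *
        (Poly_Mapping.single 0 (pmf ?R es) * (shifted_monom (mset e) * shifted_monom (mset (concat es)))))"
    by (simp add: genfun_bind fin finR genfun_map shifted_monom_union sum_distrib_left)
  also have "\<dots> = genfun (map_pmf mset (E x)) * genfun (map_pmf (\<lambda>es. mset (concat es)) ?R)"
    by (simp add: genfun_map fin finR sum_product mult_ac)
  finally show ?case by (simp add: Cons)
qed simp

text \<open>Permuting the messages keeps their multiset, so under \<open>mset\<close> the random
  permutation disappears.\<close>

lemma map_mset_shuffled:
  fixes E :: "'a \<Rightarrow> 'b list pmf"
  shows "map_pmf mset (shuffled E xs) = map_pmf (\<lambda>es. mset (concat es)) (encs E xs)"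
proof -
  have "map_pmf (\<lambda>\<pi>. mset (permute_list \<pi> ys)) (pmf_of_set {\<pi>. \<pi> permutes {..<length ys}})
      = return_pmf (mset ys)" for ys :: "'b list"
  proof -
    have "map_pmf (\<lambda>\<pi>. mset (permute_list \<pi> ys)) (pmf_of_set {\<pi>. \<pi> permutes {..<length ys}})
      = map_pmf (\<lambda>_. mset ys) (pmf_of_set {\<pi>. \<pi> permutes {..<length ys}})"
      by (intro map_pmf_cong refl) (subst (asm) set_pmf_of_set; auto simp: finite_permutations intro: permutes_id)
    thus ?thesis by simp
  qed
  thus ?thesis
    by (simp add: shuffled_def map_bind_pmf map_pmf_def bind_assoc_pmf bind_return_pmf)
qed

section \<open>Statistical distance\<close>

lemma prob_diff_le_SD: "\<bar>measure_pmf.prob p A - measure_pmf.prob q A\<bar> \<le> SD p q"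
  unfolding SD_def
proof (rule cSUP_upper)
  show "bdd_above (range (\<lambda>A. \<bar>measure_pmf.prob p A - measure_pmf.prob q A\<bar>))"
  proof (rule bdd_aboveI2[of _ _ 1])
    fix A
    show "\<bar>measure_pmf.prob p A - measure_pmf.prob q A\<bar> \<le> 1"
      using measure_pmf.prob_le_1[of p A] measure_pmf.prob_le_1[of q A]
        measure_nonneg[of p A] measure_nonneg[of q A] by linarith
  qed
qed simp

lemma SD_nonneg: "0 \<le> SD p q"
  using prob_diff_le_SD[of p "{}" q] by simp

lemma SD_map_le: "SD (map_pmf f p) (map_pmf f q) \<le> SD p q"
  unfolding SD_def[of "map_pmf f p"]
  by (intro cSUP_least) (auto intro: prob_diff_le_SD)

text \<open>Splitting \<open>S\<close> by the sign of the difference turns each half of the sum into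
  the probability gap of one event.\<close>

lemma l1_le_SD:
  assumes "finite S"
  shows "(\<Sum>s\<in>S. \<bar>pmf p s - pmf q s\<bar>) \<le> 2 * SD p q"
proof -
  let ?A = "{s\<in>S. pmf p s > pmf q s}" and ?B = "{s\<in>S. \<not> pmf p s > pmf q s}"
  have "(\<Sum>s\<in>S. \<bar>pmf p s - pmf q s\<bar>) = (\<Sum>s\<in>?A. \<bar>pmf p s - pmf q s\<bar>) + (\<Sum>s\<in>?B. \<bar>pmf p s - pmf q s\<bar>)"
    using assms by (subst sum.union_disjoint[symmetric]) (auto intro: sum.cong)
  also have "(\<Sum>s\<in>?A. \<bar>pmf p s - pmf q s\<bar>) = (\<Sum>s\<in>?A. pmf p s - pmf q s)"
    by (intro sum.cong) auto
  also have "\<dots> = measure_pmf.prob p ?A - measure_pmf.prob q ?A"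
    using assms by (simp add: sum_subtractf measure_measure_pmf_finite)
  also have "(\<Sum>s\<in>?B. \<bar>pmf p s - pmf q s\<bar>) = (\<Sum>s\<in>?B. pmf q s - pmf p s)"
    by (intro sum.cong) auto
  also have "\<dots> = measure_pmf.prob q ?B - measure_pmf.prob p ?B"
    using assms by (simp add: sum_subtractf measure_measure_pmf_finite)
  finally show ?thesis
    using prob_diff_le_SD[of p ?A q] prob_diff_le_SD[of p ?B q] by linarith
qed

section \<open>Generating functions versus statistical distance\<close>

lemma genfun_diff:
  assumes "finite S" "set_pmf P \<subseteq> S" "set_pmf Q \<subseteq> S"
  shows "genfun P - genfun Q =
    (\<Sum>M\<in>S. Poly_Mapping.single 0 (pmf P M - pmf Q M) * shifted_monom M)"
  by (simp add: genfun_superset[OF assms(1,2)] genfun_superset[OF assms(1,3)] left_diff_distrib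
      single_diff sum_subtractf)

text \<open>The l1 distance of the laws is at most \<open>2 * SD P Q\<close>, and each shifted
  monomial involved has norm at most \<open>(1 + r) ^ k\<close>.\<close>

lemma wnorm_genfun_diff_le:
  assumes r: "0 \<le> r" and fin: "finite (set_pmf P)" "finite (set_pmf Q)"
    and size: "\<And>M. M \<in> set_pmf P \<union> set_pmf Q \<Longrightarrow> size M = k"
  shows "wnorm r (genfun P - genfun Q) \<le> 2 * SD P Q * (1 + r) ^ k"
proof -
  let ?S = "set_pmf P \<union> set_pmf Q"
  have "wnorm r (genfun P - genfun Q) \<le>
      (\<Sum>M\<in>?S. wnorm r (Poly_Mapping.single 0 (pmf P M - pmf Q M) * shifted_monom M))"
    using fin by (subst genfun_diff[of ?S]) (auto intro: wnorm_sum r)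
  also have "\<dots> \<le> (\<Sum>M\<in>?S. \<bar>pmf P M - pmf Q M\<bar> * (1 + r) ^ k)"
  proof (intro sum_mono order_trans[OF wnorm_const_mult[OF r]] mult_left_mono)
    fix M assume "M \<in> ?S"
    thus "wnorm r (shifted_monom M) \<le> (1 + r) ^ k"
      using wnorm_le_near_one[OF r shifted_monom_near_one[OF r]] size by metis
  qed simp
  also have "\<dots> \<le> 2 * SD P Q * (1 + r) ^ k"
    unfolding sum_distrib_right[symmetric] using fin r by (intro mult_right_mono l1_le_SD) auto
  finally show ?thesis .
qed

text \<open>As all multisets have size \<open>k\<close>, each degree-\<open>k\<close> coefficient
  sees only one of them. By disjointness the coefficients on the support of \<open>P\<close> are
  those of \<open>pmf P\<close>; their total mass 1 gets weight \<open>r ^ k\<close>.\<close>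

lemma wnorm_genfun_diff_ge:
  assumes r: "0 \<le> r" and fin: "finite (set_pmf P)" "finite (set_pmf Q)"
    and size: "\<And>M. M \<in> set_pmf P \<union> set_pmf Q \<Longrightarrow> size M = k"
    and disj: "set_pmf P \<inter> set_pmf Q = {}"
  shows "r ^ k \<le> wnorm r (genfun P - genfun Q)"
proof -
  let ?S = "set_pmf P \<union> set_pmf Q" and ?D = "genfun P - genfun Q"
  have D: "Poly_Mapping.lookup ?D N = pmf P N" if N: "N \<in> set_pmf P" for N
  proof -
    have "Poly_Mapping.lookup ?D N = (\<Sum>M\<in>?S. (pmf P M - pmf Q M) * Poly_Mapping.lookup (shifted_monom M) N)"
      using fin by (subst genfun_diff[of ?S]) (auto simp: lookup_sum lookup_const_mult)
    also have "\<dots> = (\<Sum>M\<in>?S. if N = M then pmf P M - pmf Q M else 0)"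
      using N size by (intro sum.cong) (auto simp: lookup_shifted_monom)
    also have "\<dots> = pmf P N - pmf Q N" using N fin by simp
    also have "pmf Q N = 0" using N disj by (auto simp: set_pmf_iff)
    finally show ?thesis by simp
  qed
  have "r ^ k = (\<Sum>N\<in>set_pmf P. pmf P N) * r ^ k"
    using fin by (simp add: sum_pmf_eq_1)
  also have "\<dots> = (\<Sum>N\<in>set_pmf P. \<bar>Poly_Mapping.lookup ?D N\<bar> * r ^ size N)"
    unfolding sum_distrib_right using D size by (intro sum.cong) auto
  also have "\<dots> \<le> (\<Sum>N\<in>set_pmf P \<union> Poly_Mapping.keys ?D. \<bar>Poly_Mapping.lookup ?D N\<bar> * r ^ size N)"
    using fin r by (intro sum_mono2) auto
  also have "\<dots> = wnorm r ?D"
    using fin by (intro wnorm_superset[symmetric]) auto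
  finally show ?thesis .
qed

text \<open>The probabilities sum to 1, so \<open>genfun P - 1\<close> is a convex combination of
  the polynomials \<open>shifted_monom M - 1\<close>.\<close>

lemma genfun_near_one:
  assumes r: "0 \<le> r" and fin: "finite (set_pmf P)"
    and size: "\<And>M. M \<in> set_pmf P \<Longrightarrow> size M = k"
  shows "wnorm r (genfun P - 1) \<le> (1 + r) ^ k - 1"
proof -
  have "(1 :: 'a gf) = Poly_Mapping.single 0 (\<Sum>M\<in>set_pmf P. pmf P M)"
    using fin by (simp add: sum_pmf_eq_1)
  hence "genfun P - 1 = (\<Sum>M\<in>set_pmf P. Poly_Mapping.single 0 (pmf P M) * (shifted_monom M - 1))"
    by (simp add: genfun_def single_0_sum sum_subtractf right_diff_distrib)
  hence "wnorm r (genfun P - 1) \<le>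
      (\<Sum>M\<in>set_pmf P. wnorm r (Poly_Mapping.single 0 (pmf P M) * (shifted_monom M - 1)))"
    by (simp only:) (rule wnorm_sum[OF r])
  also have "\<dots> \<le> (\<Sum>M\<in>set_pmf P. pmf P M * ((1 + r) ^ k - 1))"
  proof (intro sum_mono order_trans[OF wnorm_const_mult[OF r]])
    fix M assume "M \<in> set_pmf P"
    thus "\<bar>pmf P M\<bar> * wnorm r (shifted_monom M - 1) \<le> pmf P M * ((1 + r) ^ k - 1)"
      using shifted_monom_near_one[OF r, of M] size by (auto intro: mult_left_mono)
  qed
  also have "\<dots> = (1 + r) ^ k - 1"
    using fin by (simp add: sum_pmf_eq_1 flip: sum_distrib_right)
  finally show ?thesis .
qed

section \<open>Correctness of the protocol and the final estimate\<close>

lemma agg_protocol_disjoint_encodings: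
  assumes "is_agg_protocol n m l Enc A" "1 \<le> n" "x \<noteq> 0"
  shows "set_pmf (map_pmf mset (Enc x)) \<inter> set_pmf (map_pmf mset (Enc 0)) = {}"
proof (rule ccontr)
  assume "\<not> ?thesis"
  then obtain e e' where e: "e \<in> set_pmf (Enc x)" "e' \<in> set_pmf (Enc 0)" "mset e = mset e'"
    by auto
  have dec: "A (permute_list \<pi> (concat es)) = sum_list xs"
    if "length xs = n" "length es = n" "\<And>i. i < n \<Longrightarrow> es ! i \<in> set_pmf (Enc (xs ! i))"
      "\<pi> permutes {..<n * m}" for xs es \<pi>
    using assms(1) that unfolding is_agg_protocol_def by blast
  have len: "length e = m" "length e' = m"
    using assms(1) e unfolding is_agg_protocol_def by blast+
  \<comment> \<open>With equal multisets, \<open>?es\<close> and \<open>?fs\<close> are permutations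
    of each other, yet they encode inputs with sums \<open>x\<close> and 0, so the analyzer cannot
    be right on both.\<close>
  let ?xs = "x # replicate (n - 1) 0" and ?es = "e # replicate (n - 1) e'"
  let ?ys = "replicate n (0 :: 'a)" and ?fs = "replicate n e'"
  have fs: "?fs = e' # replicate (n - 1) e'"
    using assms(2) by (cases n) auto
  have "mset (concat ?fs) = mset (concat ?es)"
    unfolding fs using e(3) by simp
  then obtain \<pi> where \<pi>: "\<pi> permutes {..<length (concat ?es)}" "permute_list \<pi> (concat ?es) = concat ?fs"
    by (rule mset_eq_permutation)
  have "length (concat ?es) = n * m"
    using assms(2) len by (cases n) (auto simp: length_concat sum_list_replicate)
  with \<pi> have "A (concat ?fs) = sum_list ?xs"
    using dec[of ?xs ?es \<pi>] e assms(2) by (auto simp: nth_Cons split: nat.splits)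
  moreover have "A (concat ?fs) = sum_list ?ys"
    using dec[of ?ys ?fs id] e permutes_id by (auto simp: permute_list_id)
  ultimately show False using assms(3) by (simp add: sum_list_replicate)
qed

text \<open>For \<open>r = 1 / (3 * k)\<close>, Bernoulli gives
  \<open>(1 - r) ^ k \<ge> 1 - k * r = 2 / 3\<close>, and \<open>(1 + r) * (1 - r) \<le> 1\<close>
  carries this over to \<open>1 + r\<close>.\<close>

lemma one_plus_inverse_power_le:
  assumes "1 \<le> k" shows "(1 + 1 / (3 * real k)) ^ k \<le> 3 / 2"
proof -
  let ?r = "1 / (3 * real k)"
  have r: "0 \<le> ?r" "?r \<le> 1" using assms by (auto simp: field_simps)
  have "2 / 3 \<le> (1 - ?r) ^ k"
    using Bernoulli_inequality[of "- ?r" k] r assms by simp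
  hence "(1 + ?r) ^ k * (2 / 3) \<le> (1 + ?r) ^ k * (1 - ?r) ^ k"
    using r by (intro mult_left_mono) auto
  also have "\<dots> = (1 - ?r ^ 2) ^ k"
    by (simp add: power2_eq_square algebra_simps flip: power_mult_distrib)
  also have "\<dots> \<le> 1"
    using r by (intro power_le_one) (auto simp: power_le_one)
  finally show ?thesis by simp
qed

lemma size_mset_concat_encs:
  assumes "\<And>x e. e \<in> set_pmf (E x) \<Longrightarrow> length e = m" "es \<in> set_pmf (encs E xs)"
  shows "size (mset (concat es)) = length xs * m"
  using assms(2)
  by (induction xs arbitrary: es) (auto dest: assms(1))

theorem mainTheorem15:
  fixes n m l :: nat
    and Enc :: "'a::{field,finite} \<Rightarrow> nat list pmf"
    and A :: "nat list \<Rightarrow> 'a"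
  assumes "n \<ge> 3" and "m \<ge> 1"
    and "is_agg_protocol n m l Enc A"
  shows "\<exists>xs :: 'a list. length xs = n \<and> sum_list xs = 0 \<and>
           SD (shuffled Enc (replicate n 0)) (shuffled Enc xs)
             \<ge> 1 / (10 * real n * real m) ^ (5 * m)"
proof (rule ccontr)
  define \<epsilon> where "\<epsilon> = 1 / (10 * real n * real m) ^ (5 * m)"
  assume no_witness: "\<not> ?thesis"
  have SD: "SD (shuffled Enc (replicate n 0)) (shuffled Enc xs) < \<epsilon>"
    if "length xs = n" "sum_list xs = 0" for xs
  proof (rule ccontr)
    assume "\<not> ?thesis"
    hence "1 / (10 * real n * real m) ^ (5 * m) \<le> SD (shuffled Enc (replicate n 0)) (shuffled Enc xs)"
      by (simp add: \<epsilon>_def)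
    with no_witness that show False by blast
  qed
  have "n * m \<ge> 1" using assms(1,2) by simp
  \<comment> \<open>This \<open>r\<close> keeps \<open>(1 + r) ^ (n * m)\<close>, the bound for all
    messages together, at most 3/2; \<open>c\<close> below is the share of one party.\<close>
  define r where "r = 1 / (3 * real (n * m))"
  have r: "0 \<le> r" by (simp add: r_def)
  define c where "c = (1 + r) ^ m"
  have c: "1 \<le> c" "c ^ n \<le> 3 / 2"
    using one_plus_inverse_power_le[OF \<open>n * m \<ge> 1\<close>] r
    by (simp_all add: c_def mult.commute one_le_power r_def flip: power_mult)
  have len: "length e = m" and msgs: "set e \<subseteq> {1..l}" if "e \<in> set_pmf (Enc x)" for x e
    using assms(3) that unfolding is_agg_protocol_def by blast+
  have fin: "finite (set_pmf (Enc x))" for x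
    by (rule finite_subset[OF _ finite_lists_length_eq[of "{1..l}" m]]) (use len msgs in blast, simp)
  define E where "E x = map_pmf mset (Enc x)" for x
  have finE: "finite (set_pmf (E x))" and sizeE: "\<And>M. M \<in> set_pmf (E x) \<Longrightarrow> size M = m" for x
    using fin len by (auto simp: E_def)
  \<comment> \<open>Passing to multisets does not increase the distance and removes the shuffle, so
    \<open>genfun (T xs)\<close> is a product over the parties.\<close>
  define T where "T xs = map_pmf mset (shuffled Enc xs)" for xs
  have T: "T xs = map_pmf (\<lambda>es. mset (concat es)) (encs Enc xs)" for xs
    by (simp add: T_def map_mset_shuffled)
  have prods: "wnorm r (prod_list (map (\<lambda>x. genfun (E x)) xs) - genfun (E 0) ^ n) \<le> 3 * \<epsilon>"
    if xs: "length xs = n" "sum_list xs = 0" for xs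
  proof -
    have "wnorm r (genfun (T (replicate n 0)) - genfun (T xs)) \<le>
        2 * SD (T (replicate n 0)) (T xs) * (1 + r) ^ (n * m)"
      using finite_set_pmf_encs[of Enc] fin size_mset_concat_encs[of Enc m, OF len] xs(1)
      by (intro wnorm_genfun_diff_le r) (fastforce simp: T simp del: size_mset)+
    \<comment> \<open>The factor 3/2 bounds \<open>c ^ n = (1 + r) ^ (n * m)\<close>.\<close>
    also have "\<dots> \<le> 2 * \<epsilon> * (3 / 2)"
      using SD_map_le[of mset "shuffled Enc (replicate n 0)" "shuffled Enc xs"] SD[OF xs] c(2) r
      by (intro mult_mono) (auto intro: SD_nonneg simp: T_def c_def mult.commute \<epsilon>_def simp flip: power_mult)
    finally have "wnorm r (genfun (T xs) - genfun (T (replicate n 0))) \<le> 3 * \<epsilon>"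
      by (subst wnorm_minus_commute) simp
    thus ?thesis
      by (simp add: T genfun_encs[OF fin] E_def)
  qed
  have "r ^ m \<le> wnorm r (genfun (E 1) - genfun (E 0))"
    using agg_protocol_disjoint_encodings[OF assms(3), of 1] finE sizeE assms(1)
    by (intro wnorm_genfun_diff_ge r) (auto simp flip: E_def)
  also have "\<dots> \<le> 8 * (3 * \<epsilon>)"
    by (rule almost_constant_of_zero_sum_products[of r n c "\<lambda>x. genfun (E x)"])
      (use r assms(1) c prods genfun_near_one[OF r finE sizeE] in \<open>auto simp: c_def\<close>)
  finally have le: "r ^ m \<le> 24 * \<epsilon>" by simp
  define t where "t = real (n * m)"
  have t: "3 \<le> t" unfolding t_def using mult_le_mono[OF assms(1,2)] by linarith
  \<comment> \<open>Of the exponent \<open>5 * m\<close>, one \<open>m\<close> absorbs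
    \<open>(3 * t) ^ m\<close>; the other \<open>4 * m\<close> yields at least
    \<open>30 ^ 4 > 24\<close>, since \<open>10 * t \<ge> 30\<close> and
    \<open>m \<ge> 1\<close>.\<close>
  have "24 * (3 * t) ^ m < 30 ^ 4 * (10 * t) ^ m"
    using t by (intro mult_less_le_imp_less power_mono) auto
  also have "\<dots> \<le> (10 * t) ^ (4 * m) * (10 * t) ^ m"
  proof (intro mult_right_mono)
    have "(30::real) ^ 4 \<le> 30 ^ (4 * m)" using assms(2) by (intro power_increasing) auto
    also have "\<dots> \<le> (10 * t) ^ (4 * m)" using t by (intro power_mono) auto
    finally show "(30::real) ^ 4 \<le> (10 * t) ^ (4 * m)" .
  qed (use t in auto)
  also have "\<dots> = (10 * t) ^ (5 * m)" by (simp only: power_add[symmetric]) simp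
  finally have "24 * (3 * t) ^ m < (10 * t) ^ (5 * m)" .
  moreover have "24 / b < 1 / a" if "24 * a < b" "0 < a" for a b :: real
    using that by (simp add: field_simps)
  moreover have "0 < (3 * t) ^ m" using t by simp
  ultimately have "24 / (10 * t) ^ (5 * m) < 1 / (3 * t) ^ m" by blast
  moreover have "r ^ m = 1 / (3 * t) ^ m"
    by (simp add: r_def t_def power_one_over)
  moreover have "\<epsilon> = 1 / (10 * t) ^ (5 * m)"
    by (simp add: \<epsilon>_def t_def mult.assoc)
  ultimately show False using le by simp
qed

end
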